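(* Let $(S,+,0,\bullet,1)$ be a partial commutative semiring satisfying the standing assumptions below (including that $(S,\sqsubseteq)$ is a complete lattice), let $F X=\coprod_{\lambda\in\Lambda}X^{\mathrm{ar}(\lambda)}$, and let $(C,\gamma)$ be a $\mathsf{T}_S\circ F$-coalgebra. Then for every closed formula $\varphi\in\mu\mathcal{L}^0_\Lambda$ and every $c\in C$, the step-wise semantics and the path-based semantics agree: $[\![\varphi]\!]_\gamma(c)=(\!|\varphi|\!)_\gamma(c)$, where $(\!|\varphi|\!)_\gamma(c)=\mu_\gamma(\mathsf{Paths}_c(\varphi))$.
   Context: A partial commutative semiring is a tuple $(S,+,0,\bullet,1)$ where $+$ is a partial binary operation on $S$, commutative and associative whenever defined, with unit $0$; $(S,\bullet,1)$ is a commutative monoid; $s\bullet 0=0$ for all $s$; and whenever $t+u$ is defined, $s\bullet t+s\bullet u$ is defined and equals $s\bullet(t+u)$. Define $x\sqsubseteq y$ iff $x+z=y$ for some $z\in S$. Standing assumptions: $\sqsubseteq$ is a partial order in which increasing $\omega$-chains have suprema and decreasing $\omega$-chains have infima, $1$ is the top element, $+$ and $\bullet$ preserve suprema of increasing $\omega$-chains and infima of decreasing $\omega$-chains in each argument; moreover $(S,\sqsubseteq)$ is a complete lattice. $S$-valued functions are ordered pointwise. For a set $X$, $\mathsf{T}_SX$ is the set of $\varphi:X\to S$ with finite support $\{x\mid\varphi(x)\neq 0\}$ such that the sum of the values over the support is defined; $\sum_{i\in I}c_ix_i$ ($I$ finite) denotes the element mapping $x_i$ to $c_i$ and everything else to $0$.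 $\Lambda$ is a set of symbols with arities $\mathrm{ar}(\lambda)\in\mathbb{N}$; elements of $FX$ are written $\iota_\lambda(x_1,\dots,x_{\mathrm{ar}(\lambda)})$. A $\mathsf{T}_S\circ F$-coalgebra is a set $C$ with a map $\gamma:C\to\mathsf{T}_S(FC)$. The $\nu$-extent $\mathsf{ext}_\gamma:C\to S$ is the greatest fixpoint of the operator on $S^C$ sending $p$ to $c\mapsto\sum_{\lambda\in\Lambda}\sum_{(c_1,\dots,c_n)\in C^{n},\,n=\mathrm{ar}(\lambda)}\gamma(c)(\iota_\lambda(c_1,\dots,c_n))\bullet p(c_1)\bullet\cdots\bullet p(c_n)$ (a finite sum over the support of $\gamma(c)$; empty products equal $1$). Logic: for a set $\mathcal V$ of variables, formulas of $\mu\mathcal{L}^{\mathcal V}_\Lambda$ are $\varphi::=\top\mid x\mid[\lambda](\varphi_1,\dots,\varphi_{\mathrm{ar}(\lambda)})\mid\sum_{i\in I}c_i\bullet\varphi_i\mid\mu x.\varphi\mid\nu x.\varphi$ with $x\in\mathcal V$, $\lambda\in\Lambda$, $I$ finite, $c_i\in S$ with $\sum_{i\in I}c_i$ defined; $\bot$ is the empty weighted sum. $\mu\mathcal{L}^0_\Lambda$ is the set of closed formulas in which no weighted sum other than $\bot$ occurs. Step-wise semantics, for a valuation $V:\mathcal V\to S^C$: $[\![\top]\!]^V_\gamma=\mathsf{ext}_\gamma$; $[\![x]\!]^V_\gamma=V(x)$; $[\![\sum_i c_i\bullet\varphi_i]\!]^V_\gamma(c)=\sum_i c_i\bullet[\![\varphi_i]\!]^V_\gamma(c)$;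 $[\![[\lambda](\varphi_1,\dots,\varphi_n)]\!]^V_\gamma(c)=\sum_{(c_1,\dots,c_n)}\gamma(c)(\iota_\lambda(c_1,\dots,c_n))\bullet[\![\varphi_1]\!]^V_\gamma(c_1)\bullet\cdots\bullet[\![\varphi_n]\!]^V_\gamma(c_n)$; $[\![\mu x.\varphi]\!]^V_\gamma$ and $[\![\nu x.\varphi]\!]^V_\gamma$ are the least, resp. greatest, fixpoint of $p\mapsto[\![\varphi]\!]^{V[p/x]}_\gamma$ on $S^C$. For closed $\varphi$ write $[\![\varphi]\!]_\gamma$. Paths: a path is a possibly infinite ordered tree each node of which is labelled by a pair $(c,\lambda)\in C\times\Lambda$ and has exactly $\mathrm{ar}(\lambda)$ children (an element of the final coalgebra of $X\mapsto C\times FX$). A path from $c$ in $(C,\gamma)$ is a path whose root is labelled $(c,\lambda)$ for some $\lambda$ and such that at every node labelled $(d,\lambda)$ whose children have root states $d_1,\dots,d_n$ we have $\gamma(d)(\iota_\lambda(d_1,\dots,d_n))\neq 0$. $\mathsf{Paths}_c$ is the set of paths from $c$. If $\gamma(c)(\iota_\lambda(c_1,\dots,c_n))\neq0$ and $P_i\subseteq\mathsf{Paths}_{c_i}$, let $(c,\lambda)(c_1,\dots,c_n)[P_1,\dots,P_n]$ be the set of paths with root $(c,\lambda)$ whose $i$-th child subtree lies in $P_i$. $\mathcal M_c$ is the least family of subsets of $\mathsf{Paths}_c$ containing $\mathsf{Paths}_c$, containing $(c,\lambda)(c_1,\dots,c_n)[P_1,\dots,P_n]$ whenever $P_i\in\mathcal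 M_{c_i}$, and closed under finite unions of pairwise disjoint sets (so $\emptyset\in\mathcal M_c$), unions of increasing $\omega$-chains and intersections of decreasing $\omega$-chains. The induced measure $\mu_\gamma$ is defined inductively on these sets by: $\mu_\gamma(\mathsf{Paths}_c)=\mathsf{ext}_\gamma(c)$; $\mu_\gamma((c,\lambda)(c_1,\dots,c_n)[P_1,\dots,P_n])=\gamma(c)(\iota_\lambda(c_1,\dots,c_n))\bullet\mu_\gamma(P_1)\bullet\cdots\bullet\mu_\gamma(P_n)$; $\mu_\gamma$ of a finite pairwise disjoint union is the sum (so $\mu_\gamma(\emptyset)=0$); $\mu_\gamma$ of an increasing union is the supremum and of a decreasing intersection is the infimum of the values. Path satisfaction: for a tree $z$ with root $(c,\lambda)$ and child subtrees $z_1,\dots,z_n$ (and a valuation of variables by sets of trees), $\bot$ holds nowhere, $\top$ everywhere, $[\lambda'](\varphi_1,\dots,\varphi_m)$ holds at $z$ iff $\lambda'=\lambda$ and $z_i$ satisfies $\varphi_i$ for all $i$, and $\mu x.\varphi$ / $\nu x.\varphi$ denote the least / greatest fixpoint of the induced monotone operator on sets of trees. $\mathsf{Paths}_c(\varphi)$ is the set of $z\in\mathsf{Paths}_c$ satisfying $\varphi$ (it belongs to $\mathcal M_c$).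
   Formalization: Formal version requires each ν-bound variable to lie under a modality (νx.x has step-wise value 1 but path measure ext); as the clauses for μ_γ may be inconsistent, it shows they assign [[φ]](c) to Paths_c(φ) and that any function satisfying them has this value. *)

theory Defs
  imports Main "HOL-Library.Disjoint_Sets"
begin

(* The partial addition is modelled by an option-valued operation. Equations between
   option-valued terms are Kleene equalities: both sides undefined, or both defined and equal. *)
class partial_comm_semiring = comm_monoid_mult + zero + complete_lattice +
  fixes padd :: "'a \<Rightarrow> 'a \<Rightarrow> 'a option"
  assumes padd_commute: "padd x y = padd y x"
    and padd_assoc: "Option.bind (padd x y) (\<lambda>s. padd s z) = Option.bind (padd y z) (\<lambda>s. padd x s)"
    and padd_zero: "padd x 0 = Some x"
    and times_zero: "x * 0 = 0"
    and times_padd: "padd y z = Some s \<Longrightarrow> padd (x * y) (x * z) = Some (x * s)"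
    and le_iff_padd: "x \<le> y \<longleftrightarrow> (\<exists>z. padd x z = Some y)"
    and one_eq_top: "1 = top"
    and padd_Sup_chain:
      "(\<And>n::nat. u n \<le> u (Suc n)) \<Longrightarrow> (\<And>n. padd x (u n) = Some (w n)) \<Longrightarrow>
        padd x (Sup (range u)) = Some (Sup (range w))"
    and padd_Inf_chain:
      "(\<And>n::nat. u (Suc n) \<le> u n) \<Longrightarrow> (\<And>n. padd x (u n) = Some (w n)) \<Longrightarrow>
        padd x (Inf (range u)) = Some (Inf (range w))"
    and times_Sup_chain:
      "(\<And>n::nat. u n \<le> u (Suc n)) \<Longrightarrow> x * Sup (range u) = Sup (range (\<lambda>n. x * u n))"
    and times_Inf_chain:
      "(\<And>n::nat. u (Suc n) \<le> u n) \<Longrightarrow> x * Inf (range u) = Inf (range (\<lambda>n. x * u n))"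

definition psum :: "('i \<Rightarrow> 's::partial_comm_semiring) \<Rightarrow> 'i set \<Rightarrow> 's option" where
  "psum f A = Finite_Set.fold (\<lambda>i acc. Option.bind acc (padd (f i))) (Some 0) A"

definition psum_list :: "'s::partial_comm_semiring list \<Rightarrow> 's option" where
  "psum_list xs = foldr (\<lambda>x acc. Option.bind acc (padd x)) xs (Some 0)"


definition TS :: "'x set \<Rightarrow> ('x \<Rightarrow> 's::partial_comm_semiring) set" where
  "TS X = {f. finite {x. f x \<noteq> 0} \<and> {x. f x \<noteq> 0} \<subseteq> X \<and> psum f {x. f x \<noteq> 0} \<noteq> None}"

(* The element iota_l (x_1, ..., x_n) of the coproduct is the pair (l, [x_1, ..., x_n]). *)
definition polyF :: "('l \<Rightarrow> nat) \<Rightarrow> 'x set \<Rightarrow> ('l \<times> 'x list) set" where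
  "polyF ar X = {(l, xs). length xs = ar l \<and> set xs \<subseteq> X}"

type_synonym ('c, 'l, 's) coalg = "'c \<Rightarrow> 'l \<times> 'c list \<Rightarrow> 's"

definition coalgebra :: "('l \<Rightarrow> nat) \<Rightarrow> ('c, 'l, 's::partial_comm_semiring) coalg \<Rightarrow> bool" where
  "coalgebra ar \<gamma> \<longleftrightarrow> (\<forall>c. \<gamma> c \<in> TS (polyF ar UNIV))"

definition ext :: "('c, 'l, 's::partial_comm_semiring) coalg \<Rightarrow> 'c \<Rightarrow> 's" where
  "ext \<gamma> = gfp (\<lambda>p c. the (psum (\<lambda>(l, cs). \<gamma> c (l, cs) * prod_list (map p cs)) {t. \<gamma> c t \<noteq> 0}))"


datatype ('l, 'v, 's) form =
    Top
  | Var 'v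
  | Modal 'l "('l, 'v, 's) form list"
  | WSum "('s \<times> ('l, 'v, 's) form) list"
  | Mu 'v "('l, 'v, 's) form"
  | Nu 'v "('l, 'v, 's) form"

abbreviation Bot :: "('l, 'v, 's) form" where
  "Bot \<equiv> WSum []"

primrec wf_form :: "('l \<Rightarrow> nat) \<Rightarrow> ('l, 'v, 's::partial_comm_semiring) form \<Rightarrow> bool" where
  "wf_form ar Top \<longleftrightarrow> True"
| "wf_form ar (Var x) \<longleftrightarrow> True"
| "wf_form ar (Modal l \<phi>s) \<longleftrightarrow> length \<phi>s = ar l \<and> list_all id (map (wf_form ar) \<phi>s)"
| "wf_form ar (WSum ws) \<longleftrightarrow>
    psum_list (map fst ws) \<noteq> None \<and> list_all snd (map (map_prod id (wf_form ar)) ws)"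
| "wf_form ar (Mu x \<phi>) \<longleftrightarrow> wf_form ar \<phi>"
| "wf_form ar (Nu x \<phi>) \<longleftrightarrow> wf_form ar \<phi>"

primrec fv :: "('l, 'v, 's) form \<Rightarrow> 'v set" where
  "fv Top = {}"
| "fv (Var x) = {x}"
| "fv (Modal l \<phi>s) = \<Union> (set (map fv \<phi>s))"
| "fv (WSum ws) = \<Union> (snd ` set (map (map_prod id fv) ws))"
| "fv (Mu x \<phi>) = fv \<phi> - {x}"
| "fv (Nu x \<phi>) = fv \<phi> - {x}"

primrec only_bot_sums :: "('l, 'v, 's) form \<Rightarrow> bool" where
  "only_bot_sums Top \<longleftrightarrow> True"
| "only_bot_sums (Var x) \<longleftrightarrow> True"
| "only_bot_sums (Modal l \<phi>s) \<longleftrightarrow> list_all id (map only_bot_sums \<phi>s)"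
| "only_bot_sums (WSum ws) \<longleftrightarrow> ws = []"
| "only_bot_sums (Mu x \<phi>) \<longleftrightarrow> only_bot_sums \<phi>"
| "only_bot_sums (Nu x \<phi>) \<longleftrightarrow> only_bot_sums \<phi>"

definition muL0 :: "('l \<Rightarrow> nat) \<Rightarrow> ('l, 'v, 's::partial_comm_semiring) form set" where
  "muL0 ar = {\<phi>. wf_form ar \<phi> \<and> fv \<phi> = {} \<and> only_bot_sums \<phi>}"

(* The variables with a free occurrence that is not in the scope of any modality. *)
primrec unguarded_vars :: "('l, 'v, 's) form \<Rightarrow> 'v set" where
  "unguarded_vars Top = {}"
| "unguarded_vars (Var x) = {x}"
| "unguarded_vars (Modal l \<phi>s) = {}"
| "unguarded_vars (WSum ws) = \<Union> (snd ` set (map (map_prod id unguarded_vars) ws))"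
| "unguarded_vars (Mu x \<phi>) = unguarded_vars \<phi> - {x}"
| "unguarded_vars (Nu x \<phi>) = unguarded_vars \<phi> - {x}"

(* Guardedness of the greatest fixpoints. The formula nu x. x, which is excluded, has
   step-wise value 1 (the top of S) in every state c, whereas the paths from c that satisfy it are
   all the paths from c, of measure ext c. Unguarded least fixpoints are harmless. *)
primrec nu_guarded :: "('l, 'v, 's) form \<Rightarrow> bool" where
  "nu_guarded Top \<longleftrightarrow> True"
| "nu_guarded (Var x) \<longleftrightarrow> True"
| "nu_guarded (Modal l \<phi>s) \<longleftrightarrow> list_all id (map nu_guarded \<phi>s)"
| "nu_guarded (WSum ws) \<longleftrightarrow> list_all snd (map (map_prod id nu_guarded) ws)"
| "nu_guarded (Mu x \<phi>) \<longleftrightarrow> nu_guarded \<phi>"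
| "nu_guarded (Nu x \<phi>) \<longleftrightarrow> x \<notin> unguarded_vars \<phi> \<and> nu_guarded \<phi>"


primrec step_sem :: "('c, 'l, 's::partial_comm_semiring) coalg \<Rightarrow> ('l, 'v, 's) form \<Rightarrow>
    ('v \<Rightarrow> 'c \<Rightarrow> 's) \<Rightarrow> 'c \<Rightarrow> 's" where
  "step_sem \<gamma> Top = (\<lambda>V. ext \<gamma>)"
| "step_sem \<gamma> (Var x) = (\<lambda>V. V x)"
| "step_sem \<gamma> (Modal l \<phi>s) = (\<lambda>V c.
    the (psum (\<lambda>cs. \<gamma> c (l, cs) * prod_list (map2 (\<lambda>s d. s V d) (map (step_sem \<gamma>) \<phi>s) cs))
      {cs. \<gamma> c (l, cs) \<noteq> 0}))"
| "step_sem \<gamma> (WSum ws) = (\<lambda>V c.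
    the (psum_list (map (\<lambda>(a, s). a * s V c) (map (map_prod id (step_sem \<gamma>)) ws))))"
| "step_sem \<gamma> (Mu x \<phi>) = (\<lambda>V. lfp (\<lambda>p. step_sem \<gamma> \<phi> (V(x := p))))"
| "step_sem \<gamma> (Nu x \<phi>) = (\<lambda>V. gfp (\<lambda>p. step_sem \<gamma> \<phi> (V(x := p))))"


codatatype ('c, 'l) tree = Node (state: 'c) (symbol: 'l) (children: "('c, 'l) tree list")

coinductive wf_tree :: "('l \<Rightarrow> nat) \<Rightarrow> ('c, 'l) tree \<Rightarrow> bool" for ar where
  "length zs = ar l \<Longrightarrow> \<forall>z\<in>set zs. wf_tree ar z \<Longrightarrow> wf_tree ar (Node c l zs)"

coinductive follows :: "('c, 'l, 's::zero) coalg \<Rightarrow> ('c, 'l) tree \<Rightarrow> bool" for \<gamma> where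
  "\<gamma> c (l, map state zs) \<noteq> 0 \<Longrightarrow> \<forall>z\<in>set zs. follows \<gamma> z \<Longrightarrow> follows \<gamma> (Node c l zs)"

definition Paths :: "('l \<Rightarrow> nat) \<Rightarrow> ('c, 'l, 's::zero) coalg \<Rightarrow> 'c \<Rightarrow> ('c, 'l) tree set" where
  "Paths ar \<gamma> c = {z. wf_tree ar z \<and> follows \<gamma> z \<and> state z = c}"

(* The set (c,l)(c_1,...,c_n)[P_1,...,P_n]; the states c_i are implicit in P_i, which is used
   only as a subset of the paths from c_i. *)
definition cylinder :: "'c \<Rightarrow> 'l \<Rightarrow> ('c, 'l) tree set list \<Rightarrow> ('c, 'l) tree set" where
  "cylinder c l Ps = {Node c l zs |zs. list_all2 (\<in>) zs Ps}"

inductive measurable :: "('l \<Rightarrow> nat) \<Rightarrow> ('c, 'l, 's::zero) coalg \<Rightarrow> 'c \<Rightarrow> ('c, 'l) tree set \<Rightarrow> bool"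
  for ar \<gamma> where
  "measurable ar \<gamma> c (Paths ar \<gamma> c)"
| "\<gamma> c (l, cs) \<noteq> 0 \<Longrightarrow> list_all2 (measurable ar \<gamma>) cs Ps \<Longrightarrow> measurable ar \<gamma> c (cylinder c l Ps)"
| "(\<forall>i<k. measurable ar \<gamma> c (P i)) \<Longrightarrow> disjoint_family_on P {..<k::nat} \<Longrightarrow>
    measurable ar \<gamma> c (\<Union>i<k. P i)"
| "(\<forall>n::nat. measurable ar \<gamma> c (P n)) \<Longrightarrow> (\<forall>n. P n \<subseteq> P (Suc n)) \<Longrightarrow> measurable ar \<gamma> c (\<Union>n. P n)"
| "(\<forall>n::nat. measurable ar \<gamma> c (P n)) \<Longrightarrow> (\<forall>n. P (Suc n) \<subseteq> P n) \<Longrightarrow> measurable ar \<gamma> c (\<Inter>n. P n)"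

(* The inductive definition of the induced measure, as a relation: measure_value ar \<gamma> c P v says
   that the defining clauses assign the value v to the set P of paths from c. For some S and \<gamma>
   (e.g. the Boolean semiring) the clauses assign several values to one set, so that
   it is not always the graph of a function. *)
inductive measure_value :: "('l \<Rightarrow> nat) \<Rightarrow> ('c, 'l, 's::partial_comm_semiring) coalg \<Rightarrow> 'c \<Rightarrow>
    ('c, 'l) tree set \<Rightarrow> 's \<Rightarrow> bool"
  for ar \<gamma> where
  "measure_value ar \<gamma> c (Paths ar \<gamma> c) (ext \<gamma> c)"
| "\<gamma> c (l, cs) \<noteq> 0 \<Longrightarrow> length Ps = length cs \<Longrightarrow> length vs = length cs \<Longrightarrow>
    (\<forall>i<length cs. measure_value ar \<gamma> (cs ! i) (Ps ! i) (vs ! i)) \<Longrightarrow>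
    measure_value ar \<gamma> c (cylinder c l Ps) (\<gamma> c (l, cs) * prod_list vs)"
| "(\<forall>i<k. measure_value ar \<gamma> c (P i) (w i)) \<Longrightarrow> disjoint_family_on P {..<k::nat} \<Longrightarrow>
    psum w {..<k} = Some v \<Longrightarrow> measure_value ar \<gamma> c (\<Union>i<k. P i) v"
| "(\<forall>n::nat. measure_value ar \<gamma> c (P n) (w n)) \<Longrightarrow> (\<forall>n. P n \<subseteq> P (Suc n)) \<Longrightarrow>
    measure_value ar \<gamma> c (\<Union>n. P n) (SUP n. w n)"
| "(\<forall>n::nat. measure_value ar \<gamma> c (P n) (w n)) \<Longrightarrow> (\<forall>n. P (Suc n) \<subseteq> P n) \<Longrightarrow>
    measure_value ar \<gamma> c (\<Inter>n. P n) (INF n. w n)"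

(* The same clauses, imposed on a family of functions m c defined on the measurable sets of paths
   from c (values on other sets are irrelevant). *)
definition induced_measure :: "('l \<Rightarrow> nat) \<Rightarrow> ('c, 'l, 's::partial_comm_semiring) coalg \<Rightarrow>
    ('c \<Rightarrow> ('c, 'l) tree set \<Rightarrow> 's) \<Rightarrow> bool" where
  "induced_measure ar \<gamma> m \<longleftrightarrow>
    (\<forall>c. m c (Paths ar \<gamma> c) = ext \<gamma> c) \<and>
    (\<forall>c l cs Ps. \<gamma> c (l, cs) \<noteq> 0 \<and> list_all2 (measurable ar \<gamma>) cs Ps \<longrightarrow>
      m c (cylinder c l Ps) = \<gamma> c (l, cs) * prod_list (map2 m cs Ps)) \<and>
    (\<forall>c P (k::nat). (\<forall>i<k. measurable ar \<gamma> c (P i)) \<and> disjoint_family_on P {..<k} \<longrightarrow>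
      psum (\<lambda>i. m c (P i)) {..<k} = Some (m c (\<Union>i<k. P i))) \<and>
    (\<forall>c P. (\<forall>n::nat. measurable ar \<gamma> c (P n)) \<and> (\<forall>n. P n \<subseteq> P (Suc n)) \<longrightarrow>
      m c (\<Union>n. P n) = (SUP n. m c (P n))) \<and>
    (\<forall>c P. (\<forall>n::nat. measurable ar \<gamma> c (P n)) \<and> (\<forall>n. P (Suc n) \<subseteq> P n) \<longrightarrow>
      m c (\<Inter>n. P n) = (INF n. m c (P n)))"


(* Satisfaction is defined on all finitely branching labelled trees; as it only refers to subtrees,
   its restriction to the trees that respect the arities is the satisfaction relation there.
   Only formulas without weighted sums other than Bot are meant to be interpreted. *)
primrec sat :: "('l, 'v, 's) form \<Rightarrow> ('v \<Rightarrow> ('c, 'l) tree set) \<Rightarrow> ('c, 'l) tree set" where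
  "sat Top = (\<lambda>W. UNIV)"
| "sat (Var x) = (\<lambda>W. W x)"
| "sat (Modal l \<phi>s) = (\<lambda>W.
    {z. symbol z = l \<and> list_all2 (\<lambda>z' s. z' \<in> s W) (children z) (map sat \<phi>s)})"
| "sat (WSum ws) = (\<lambda>W. {})"
| "sat (Mu x \<phi>) = (\<lambda>W. lfp (\<lambda>Z. sat \<phi> (W(x := Z))))"
| "sat (Nu x \<phi>) = (\<lambda>W. gfp (\<lambda>Z. sat \<phi> (W(x := Z))))"

definition Paths_sat :: "('l \<Rightarrow> nat) \<Rightarrow> ('c, 'l, 's::zero) coalg \<Rightarrow> 'c \<Rightarrow> ('l, 'v, 's) form \<Rightarrow>
    ('v \<Rightarrow> ('c, 'l) tree set) \<Rightarrow> ('c, 'l) tree set" where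
  "Paths_sat ar \<gamma> c \<phi> W = {z \<in> Paths ar \<gamma> c. z \<in> sat \<phi> W}"

end

theory Submission
  imports Defs
begin

text \<open>
  Without disjunction, both semantics are strict in every free variable: if a variable occurring
  free in a formula denotes \<open>0\<close> (or the empty set), then so does the formula. Hence
  \<open>\<mu>x. \<phi>\<close> is \<open>0\<close> (empty) if \<open>x\<close> is free in \<open>\<phi>\<close>, and equivalent to \<open>\<phi>\<close> otherwise, and it
  follows that both semantics, including nested least fixpoints, preserve infima of decreasing
  sequences of valuations. Greatest fixpoints are therefore infima of \<open>\<omega>\<close>-sequences of iterates.
  Guardedness bounds the step-wise value of every formula by the extent, so in \<open>\<nu>x. \<phi>\<close> one may
  iterate from the extent rather than from the top element of the semiring; this matches the
  iteration on sets of paths starting from all paths, and the two are compared stage by stage.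
\<close>

section \<open>Iterates and diagonal infima\<close>

text \<open>The entry at \<open>(m, n)\<close> lies above the diagonal entry at
  \<open>max m n\<close>. Continuity in each argument separately thereby becomes joint
  continuity.\<close>

lemma INF_diagonal:
  fixes w :: "nat \<Rightarrow> nat \<Rightarrow> 'a::complete_lattice"
  assumes "\<And>m n m' n'. m \<le> m' \<Longrightarrow> n \<le> n' \<Longrightarrow> w m' n' \<le> w m n"
  shows "(INF n. INF m. w m n) = (INF n. w n n)"
proof (rule antisym)
  show "(INF n. INF m. w m n) \<le> (INF n. w n n)"
    by (intro INF_greatest) (meson INF_lower2 UNIV_I order_refl)
  show "(INF n. w n n) \<le> (INF n. INF m. w m n)"
  proof (intro INF_greatest)
    fix n m
    have "(INF n. w n n) \<le> w (max m n) (max m n)" by (rule INF_lower) simp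
    also have "\<dots> \<le> w m n" by (rule assms) auto
    finally show "(INF n. w n n) \<le> w m n" .
  qed
qed

lemma antimono_funpow:
  fixes f :: "'a::order \<Rightarrow> 'a"
  assumes "mono f" "f a \<le> a"
  shows "antimono (\<lambda>n. (f ^^ n) a)"
proof -
  have "(f ^^ Suc n) a \<le> (f ^^ n) a" for n
    by (induction n) (use assms in \<open>auto dest: monoD\<close>)
  then show ?thesis by (simp add: antimono_iff_le_Suc)
qed

text \<open>Continuity along decreasing sequences puts the infimum of the iterates below its own
  image. The start \<open>a\<close> is left free because different starts occur: the top element,
  and the extent in \<open>step_sem_Nu\<close>.\<close>

lemma gfp_eq_INF_funpow:
  fixes f :: "'a::complete_lattice \<Rightarrow> 'a"
  assumes "mono f" "f a \<le> a" "gfp f \<le> a"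
    and "\<And>u::nat \<Rightarrow> 'a. antimono u \<Longrightarrow> f (INF n. u n) = (INF n. f (u n))"
  shows "gfp f = (INF n. (f ^^ n) a)"
proof (rule antisym)
  have "gfp f \<le> (f ^^ n) a" for n
  proof (induction n)
    case (Suc n)
    then have "f (gfp f) \<le> f ((f ^^ n) a)" using assms(1) by (rule monoD[rotated])
    then show ?case using gfp_unfold[OF assms(1)] by simp
  qed (use assms in simp)
  then show "gfp f \<le> (INF n. (f ^^ n) a)" by (rule INF_greatest)
  have "(INF n. (f ^^ n) a) \<le> (INF n. (f ^^ Suc n) a)"
    by (rule INF_mono) blast
  also have "\<dots> = f (INF n. (f ^^ n) a)"
    using assms(4)[OF antimono_funpow[OF assms(1,2)]] by simp
  finally show "(INF n. (f ^^ n) a) \<le> gfp f" by (rule gfp_upperbound)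
qed

section \<open>Partial commutative semirings\<close>

lemma zero_le [simp]: "(0::'s::partial_comm_semiring) \<le> x"
  using le_iff_padd padd_commute padd_zero by metis

lemma zero_times [simp]: "(0::'s::partial_comm_semiring) * x = 0"
  by (metis mult.commute times_zero)

lemma padd_zero_left: "padd 0 x = Some (x::'s::partial_comm_semiring)"
  by (metis padd_commute padd_zero)

text \<open>Write \<open>x\<close> as the sum of some \<open>d\<close> and \<open>x'\<close>. As
  \<open>(d + x') + y\<close> is defined, associativity in Kleene form forces \<open>x' + y\<close>
  to be defined too, and adding \<open>d\<close> to it gives \<open>s\<close>.\<close>

lemma padd_mono_left:
  fixes x :: "'s::partial_comm_semiring"
  assumes "padd x y = Some s" "x' \<le> x"
  shows "\<exists>t\<le>s. padd x' y = Some t"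
proof -
  obtain d where "padd d x' = Some x" using assms(2) le_iff_padd padd_commute by metis
  then have "Option.bind (padd x' y) (padd d) = Some s"
    using padd_assoc[of d x' y] assms(1) by simp
  then obtain t where "padd x' y = Some t" "padd d t = Some s"
    by (auto simp: Option.bind_eq_Some_conv)
  moreover from this have "t \<le> s" using le_iff_padd padd_commute by metis
  ultimately show ?thesis by blast
qed

lemma padd_mono:
  fixes x :: "'s::partial_comm_semiring"
  assumes "padd x y = Some s" "x' \<le> x" "y' \<le> y"
  shows "\<exists>t\<le>s. padd x' y' = Some t"
proof -
  obtain t where t: "t \<le> s" "padd y x' = Some t"
    using padd_mono_left[OF assms(1,2)] padd_commute by metis
  then obtain t' where "t' \<le> t" "padd y' x' = Some t'"
    using padd_mono_left assms(3) by blast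
  then show ?thesis using t padd_commute order_trans by metis
qed

lemma times_mono:
  fixes x :: "'s::partial_comm_semiring"
  assumes "x \<le> x'" "y \<le> y'"
  shows "x * y \<le> x' * y'"
proof -
  have "a * b \<le> a * b'" if "b \<le> b'" for a b b' :: 's
    using that times_padd le_iff_padd by metis
  then show ?thesis using assms by (metis mult.commute order_trans)
qed

lemma times_le_left: "x * y \<le> (x::'s::partial_comm_semiring)"
  by (metis mult.right_neutral one_eq_top order_refl times_mono top_greatest)

lemma times_INF:
  fixes u v :: "nat \<Rightarrow> 's::partial_comm_semiring"
  assumes "antimono u" "antimono v"
  shows "(INF n. u n) * (INF n. v n) = (INF n. u n * v n)"
proof -
  have "(INF n. u n) * (INF n. v n) = (INF n. (INF n. u n) * v n)"
    using assms(2) times_Inf_chain[of v] by (simp add: antimono_iff_le_Suc)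
  also have "\<dots> = (INF n. INF m. u m * v n)"
    using assms(1) times_Inf_chain[of u] by (simp add: antimono_iff_le_Suc mult.commute[of _ "v _"])
  also have "\<dots> = (INF n. u n * v n)"
    by (rule INF_diagonal) (meson assms antimonoD times_mono)
  finally show ?thesis .
qed

lemma padd_INF:
  fixes u v :: "nat \<Rightarrow> 's::partial_comm_semiring"
  assumes "antimono u" "antimono v" and w: "\<And>n. padd (u n) (v n) = Some (w n)"
  shows "padd (INF n. u n) (INF n. v n) = Some (INF n. w n)"
proof -
  \<comment> \<open>The off-diagonal sums exist because each is dominated termwise by the sum at
    index 0; they are needed to pass to the limit in one argument at a time.\<close>
  define z where "z m n = the (padd (u m) (v n))" for m n
  have z: "padd (u m) (v n) = Some (z m n)" for m n
    using padd_mono[OF w[of 0] antimonoD[OF assms(1)] antimonoD[OF assms(2)], of m n]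
    by (auto simp: z_def)
  have mono: "z m' n' \<le> z m n" if "m \<le> m'" "n \<le> n'" for m n m' n'
    using padd_mono[OF z antimonoD[OF assms(1) that(1)] antimonoD[OF assms(2) that(2)]] z by auto
  have "padd (v n) (INF m. u m) = Some (INF m. z m n)" for n
    using padd_Inf_chain[of u "v n" "\<lambda>m. z m n"] z assms(1) padd_commute
    by (metis antimono_iff_le_Suc)
  then have "padd (INF m. u m) (INF n. v n) = Some (INF n. INF m. z m n)"
    using padd_Inf_chain[of v "INF m. u m" "\<lambda>n. INF m. z m n"] assms(2) padd_commute
    by (metis antimono_iff_le_Suc)
  also have "(INF n. INF m. z m n) = (INF n. z n n)" by (rule INF_diagonal) (rule mono)
  finally show ?thesis using w by (simp add: z_def)
qed

section \<open>Finite products and partial sums\<close>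

lemma prod_list_mono:
  fixes f g :: "'a \<Rightarrow> 's::partial_comm_semiring"
  shows "(\<And>x. x \<in> set xs \<Longrightarrow> f x \<le> g x) \<Longrightarrow> prod_list (map f xs) \<le> prod_list (map g xs)"
  by (induction xs) (auto intro: times_mono)

lemma prod_list_zero:
  "x \<in> set xs \<Longrightarrow> f x = (0::'s::partial_comm_semiring) \<Longrightarrow> prod_list (map f xs) = 0"
  by (induction xs) (auto simp: times_zero)

lemma prod_list_INF:
  fixes u :: "nat \<Rightarrow> 'a \<Rightarrow> 's::partial_comm_semiring"
  assumes "\<And>x. x \<in> set xs \<Longrightarrow> antimono (\<lambda>n. u n x)"
  shows "prod_list (map (\<lambda>x. INF n. u n x) xs) = (INF n. prod_list (map (u n) xs))"
  using assms
proof (induction xs)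
  case (Cons x xs)
  have "antimono (\<lambda>n. prod_list (map (u n) xs))"
    by (rule antimonoI, rule prod_list_mono) (use Cons.prems in \<open>auto dest: antimonoD\<close>)
  then show ?case using times_INF[of "\<lambda>n. u n x" "\<lambda>n. prod_list (map (u n) xs)"] Cons by simp
qed simp

lemma psum_empty [simp]: "psum f {} = Some 0"
  by (simp add: psum_def)

text \<open>Commutativity and Kleene associativity make the summation step left-commutative, also
  where sums are undefined, so the fold does not depend on the order of the summands.\<close>

lemma psum_insert:
  fixes f :: "'i \<Rightarrow> 's::partial_comm_semiring"
  assumes "finite A" "i \<notin> A"
  shows "psum f (insert i A) = Option.bind (psum f A) (padd (f i))"
proof -
  have swap: "Option.bind (padd a s) (padd b) = Option.bind (padd b s) (padd a)" for a b s :: 's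
  proof -
    have "Option.bind (padd a s) (padd b) = Option.bind (padd b a) (\<lambda>t. padd t s)"
      by (simp add: padd_assoc)
    also have "\<dots> = Option.bind (padd b s) (padd a)"
      by (simp only: padd_commute[of b a] padd_assoc)
    finally show ?thesis .
  qed
  interpret comp_fun_commute "\<lambda>i acc. Option.bind acc (padd (f i))"
  proof
    fix i j
    show "(\<lambda>acc. Option.bind acc (padd (f j))) \<circ> (\<lambda>acc. Option.bind acc (padd (f i))) =
      (\<lambda>acc. Option.bind acc (padd (f i))) \<circ> (\<lambda>acc. Option.bind acc (padd (f j)))"
    proof
      fix acc
      show "((\<lambda>acc. Option.bind acc (padd (f j))) \<circ> (\<lambda>acc. Option.bind acc (padd (f i)))) acc =
        ((\<lambda>acc. Option.bind acc (padd (f i))) \<circ> (\<lambda>acc. Option.bind acc (padd (f j)))) acc"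
        by (cases acc) (auto intro: swap)
    qed
  qed
  show ?thesis using assms by (simp add: psum_def)
qed

lemma psum_cong: "(\<And>i. i \<in> A \<Longrightarrow> f i = g i) \<Longrightarrow> psum f A = psum g A"
  \<comment> \<open>The final \<open>simp\<close> settles infinite index sets, on which a fold
    returns its start value.\<close>
  by (induction A rule: infinite_finite_induct) (auto simp: psum_insert, simp add: psum_def)

lemma psum_reindex:
  assumes "finite A" "inj_on h A"
  shows "psum f (h ` A) = psum (\<lambda>i. f (h i)) A"
  using assms by (induction A) (auto simp: psum_insert)

lemma psum_zero: "finite A \<Longrightarrow> psum (\<lambda>i. 0) A = Some (0::'s::partial_comm_semiring)"
  by (induction A rule: finite_induct) (auto simp: psum_insert padd_zero)

lemma psum_mono:
  fixes f :: "'i \<Rightarrow> 's::partial_comm_semiring"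
  assumes "finite A" "psum f A = Some s" "\<And>i. i \<in> A \<Longrightarrow> g i \<le> f i"
  shows "\<exists>t\<le>s. psum g A = Some t"
  using assms
proof (induction A arbitrary: s)
  case (insert i A)
  from insert.prems(1) obtain s' where s': "psum f A = Some s'" "padd (f i) s' = Some s"
    by (auto simp: psum_insert insert.hyps Option.bind_eq_Some_conv)
  then obtain t' where t': "t' \<le> s'" "psum g A = Some t'" using insert by blast
  then show ?case using padd_mono[OF s'(2), of "g i" t'] insert.prems(2)
    by (auto simp: psum_insert insert.hyps)
qed simp

lemma psum_subset:
  fixes f :: "'i \<Rightarrow> 's::partial_comm_semiring"
  assumes "finite A" "B \<subseteq> A" "psum f A = Some s"
  shows "\<exists>t\<le>s. psum f B = Some t"
proof -
  \<comment> \<open>Padding with \<open>0\<close> outside \<open>B\<close> keeps the index set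
    \<open>A\<close>, so that monotonicity of sums applies.\<close>
  have "psum (\<lambda>i. if i \<in> B then f i else 0) A = psum f (A \<inter> B)"
    using assms(1)
  proof (induction A)
    case (insert i A)
    have "Option.bind z (padd 0) = z" for z :: "'s option"
      by (cases z) (auto simp: padd_zero_left)
    then show ?case using insert by (auto simp: psum_insert Int_insert_left)
  qed simp
  moreover have "\<exists>t\<le>s. psum (\<lambda>i. if i \<in> B then f i else 0) A = Some t"
    by (rule psum_mono[OF assms(1,3)]) auto
  ultimately show ?thesis using assms(2) by (simp add: Int_absorb1)
qed

lemma psum_INF:
  fixes u :: "nat \<Rightarrow> 'i \<Rightarrow> 's::partial_comm_semiring"
  assumes "finite A" "\<And>i. i \<in> A \<Longrightarrow> antimono (\<lambda>n. u n i)" "\<And>n. psum (u n) A = Some (w n)"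
  shows "psum (\<lambda>i. INF n. u n i) A = Some (INF n. w n)"
  using assms
proof (induction A arbitrary: w)
  case (insert i A)
  have "\<exists>s. psum (u n) A = Some s \<and> padd (u n i) s = Some (w n)" for n
    using insert.prems(2)[of n] by (auto simp: psum_insert insert.hyps Option.bind_eq_Some_conv)
  then obtain s where s: "\<And>n. psum (u n) A = Some (s n)" "\<And>n. padd (u n i) (s n) = Some (w n)"
    by metis
  have "antimono s"
  proof (rule antimonoI)
    fix m n :: nat assume "m \<le> n"
    then show "s n \<le> s m"
      using psum_mono[OF insert.hyps(1) s(1)[of m], of "u n"] insert.prems(1) s(1)
      by (auto dest: antimonoD)
  qed
  then have "padd (INF n. u n i) (INF n. s n) = Some (INF n. w n)"
    using s(2) insert.prems(1) by (intro padd_INF) auto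
  then show ?case using insert.IH[of s] insert.prems(1) s(1) by (simp add: psum_insert insert.hyps)
qed simp

text \<open>Sums weighted by coefficients \<open>a\<close> of defined total are always defined, since \<open>1\<close> is the top.\<close>

lemma psum_weighted_defined:
  fixes a :: "'i \<Rightarrow> 's::partial_comm_semiring"
  assumes "finite A" "psum a A \<noteq> None"
  shows "psum (\<lambda>i. a i * f i) A = Some (the (psum (\<lambda>i. a i * f i) A))"
  using psum_mono[OF assms(1), of a "the (psum a A)" "\<lambda>i. a i * f i"] assms(2) times_le_left
  by fastforce

lemma psum_weighted_mono:
  fixes a :: "'i \<Rightarrow> 's::partial_comm_semiring"
  assumes "finite A" "psum a A \<noteq> None" "\<And>i. i \<in> A \<Longrightarrow> f i \<le> g i"
  shows "the (psum (\<lambda>i. a i * f i) A) \<le> the (psum (\<lambda>i. a i * g i) A)"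
  using psum_mono[OF assms(1) psum_weighted_defined[OF assms(1,2), of g], of "\<lambda>i. a i * f i"]
    times_mono[OF order_refl assms(3)] by fastforce

lemma psum_weighted_INF:
  fixes a :: "'i \<Rightarrow> 's::partial_comm_semiring" and u :: "nat \<Rightarrow> 'i \<Rightarrow> 's"
  assumes "finite A" "psum a A \<noteq> None" "\<And>i. i \<in> A \<Longrightarrow> antimono (\<lambda>n. u n i)"
  shows "the (psum (\<lambda>i. a i * (INF n. u n i)) A) = (INF n. the (psum (\<lambda>i. a i * u n i) A))"
proof -
  have "psum (\<lambda>i. a i * (INF n. u n i)) A = psum (\<lambda>i. INF n. a i * u n i) A"
    using times_Inf_chain[of "\<lambda>n. u n _"] assms(3)
    by (intro psum_cong) (simp add: antimono_iff_le_Suc)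
  also have "\<dots> = Some (INF n. the (psum (\<lambda>i. a i * u n i) A))"
    using assms(1)
  proof (rule psum_INF)
    show "antimono (\<lambda>n. a i * u n i)" if "i \<in> A" for i
      using assms(3)[OF that] by (auto intro!: antimonoI times_mono dest: antimonoD)
  qed (rule psum_weighted_defined[OF assms(1,2)])
  finally show ?thesis by simp
qed

section \<open>Formulas\<close>

lemma unguarded_vars_subset_fv: "unguarded_vars \<phi> \<subseteq> fv \<phi>"
proof (induction \<phi>)
  case (WSum ws)
  then show ?case by (force simp: prod_set_defs)
qed auto

lemma antimono_upd:
  fixes V :: "nat \<Rightarrow> 'v \<Rightarrow> 'a::order"
  assumes "antimono V" "antimono u"
  shows "antimono (\<lambda>n. (V n)(x := u n))"
  using antimonoD[OF assms(1)] antimonoD[OF assms(2)]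
  by (intro antimonoI) (simp add: le_fun_def)

text \<open>Lets a continuity hypothesis on the body of a fixpoint be applied to valuations updated
  at the bound variable.\<close>

lemma INF_upd:
  fixes V :: "nat \<Rightarrow> 'v \<Rightarrow> 'a::complete_lattice"
  shows "(\<lambda>y. INF n. ((V n)(x := u n)) y) = (\<lambda>y. INF n. V n y)(x := INF n. u n)"
proof
  fix y
  show "(INF n. ((V n)(x := u n)) y) = ((\<lambda>y. INF n. V n y)(x := INF n. u n)) y"
    by (cases "y = x") simp_all
qed

section \<open>Satisfaction on trees: strictness and continuity\<close>

lemma sat_cong: "(\<And>x. x \<in> fv \<phi> \<Longrightarrow> W x = W' x) \<Longrightarrow> sat \<phi> W = sat \<phi> W'"
proof (induction \<phi> arbitrary: W W')
  case (Modal l \<phi>s)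
  have "sat \<phi> W = sat \<phi> W'" if "\<phi> \<in> set \<phi>s" for \<phi>
    using Modal.prems that by (intro Modal.IH) auto
  then show ?case by (auto simp: list_all2_conv_all_nth)
next
  case (Mu x \<phi>)
  then have "sat \<phi> (W(x := Z)) = sat \<phi> (W'(x := Z))" for Z by (intro Mu.IH) auto
  then show ?case by simp
next
  case (Nu x \<phi>)
  then have "sat \<phi> (W(x := Z)) = sat \<phi> (W'(x := Z))" for Z by (intro Nu.IH) auto
  then show ?case by simp
qed auto

text \<open>A modality constrains all children at once and \<open>Bot\<close> has no variables, so
  emptiness propagates upwards from one free variable. Under a binder the free variable differs from
  the bound one, so the fixpoint operator is constantly empty.\<close>

lemma sat_strict: "x \<in> fv \<phi> \<Longrightarrow> W x = {} \<Longrightarrow> only_bot_sums \<phi> \<Longrightarrow> sat \<phi> W = {}"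
proof (induction \<phi> arbitrary: W)
  case (Modal l \<phi>s)
  then obtain \<phi> where "\<phi> \<in> set \<phi>s" "sat \<phi> W = {}" by (auto simp: list_all_iff)
  then show ?case by (fastforce simp: list_all2_conv_all_nth in_set_conv_nth)
next
  case (Mu y \<phi>)
  then have "sat \<phi> (W(y := Z)) = {}" for Z by (intro Mu.IH) auto
  then show ?case by (simp add: lfp_const)
next
  case (Nu y \<phi>)
  then have "sat \<phi> (W(y := Z)) = {}" for Z by (intro Nu.IH) auto
  then show ?case by (simp add: gfp_const)
qed auto

lemma sat_mono: "(\<And>x. W x \<subseteq> W' x) \<Longrightarrow> sat \<phi> W \<subseteq> sat \<phi> W'"
proof (induction \<phi> arbitrary: W W')
  case (Modal l \<phi>s)
  then have "\<phi> \<in> set \<phi>s \<Longrightarrow> sat \<phi> W \<subseteq> sat \<phi> W'" for \<phi> by blast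
  then show ?case by (auto simp: list_all2_conv_all_nth subset_iff)
next
  case (Mu x \<phi>)
  then have "sat \<phi> (W(x := Z)) \<subseteq> sat \<phi> (W'(x := Z))" for Z by (intro Mu.IH) auto
  then show ?case by (auto intro!: lfp_mono)
next
  case (Nu x \<phi>)
  then have "sat \<phi> (W(x := Z)) \<subseteq> sat \<phi> (W'(x := Z))" for Z by (intro Nu.IH) auto
  then show ?case by (auto intro!: gfp_mono)
qed auto

lemma mono_sat_upd: "mono (\<lambda>Z. sat \<phi> (W(x := Z)))"
  by (rule monoI, rule sat_mono) auto

text \<open>If \<open>x\<close> is free, strictness makes the empty set a fixpoint; otherwise the
  operator is constant. Least fixpoints thus cause no difficulty for continuity along decreasing
  sequences.\<close>

lemma sat_Mu:
  assumes "only_bot_sums \<phi>"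
  shows "sat (Mu x \<phi>) W = (if x \<in> fv \<phi> then {} else sat \<phi> W)"
proof (cases "x \<in> fv \<phi>")
  case True
  then have "sat \<phi> (W(x := {})) = {}" using assms by (intro sat_strict) auto
  then have "sat (Mu x \<phi>) W \<subseteq> {}" by (auto intro!: lfp_lowerbound)
  then show ?thesis using True by simp
next
  case False
  then have "sat \<phi> (W(x := Z)) = sat \<phi> W" for Z by (intro sat_cong) auto
  then show ?thesis using False by (simp add: lfp_const)
qed

lemma sat_INT:
  fixes W :: "nat \<Rightarrow> 'v \<Rightarrow> ('c, 'l) tree set"
  shows "only_bot_sums \<phi> \<Longrightarrow> antimono W \<Longrightarrow> sat \<phi> (\<lambda>x. \<Inter>n. W n x) = (\<Inter>n. sat \<phi> (W n))"
proof (induction \<phi> arbitrary: W)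
  case (Modal l \<phi>s)
  then have "\<phi> \<in> set \<phi>s \<Longrightarrow> sat \<phi> (\<lambda>x. \<Inter>n. W n x) = (\<Inter>n. sat \<phi> (W n))" for \<phi>
    by (simp add: list_all_iff)
  then show ?case by (auto simp: list_all2_conv_all_nth)
next
  case (Mu x \<phi>)
  then show ?case by (simp add: sat_Mu del: sat.simps)
next
  case (Nu x \<phi>)
  \<comment> \<open>The greatest fixpoints at the stages decrease, and by the induction hypothesis
    their intersection is a fixpoint for the limit valuation, hence below the greatest one.\<close>
  define G where "G n = sat (Nu x \<phi>) (W n)" for n
  have G: "sat \<phi> ((W n)(x := G n)) = G n" for n
    using gfp_unfold[OF mono_sat_upd, of \<phi> "W n" x] by (simp add: G_def)
  have anti_W: "W n y \<subseteq> W m y" if "m \<le> n" for m n y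
    using antimonoD[OF Nu.prems(2) that] by (auto simp: le_fun_def)
  have "antimono G"
    unfolding G_def by (rule antimonoI, rule sat_mono) (rule anti_W)
  then have "antimono (\<lambda>n. (W n)(x := G n))"
    by (rule antimono_upd[OF Nu.prems(2)])
  then have "sat \<phi> (\<lambda>y. \<Inter>n. ((W n)(x := G n)) y) = (\<Inter>n. G n)"
    using Nu.IH[of "\<lambda>n. (W n)(x := G n)"] Nu.prems(1) G by (simp del: fun_upd_apply)
  moreover have "(\<lambda>y. \<Inter>n. ((W n)(x := G n)) y) = (\<lambda>y. \<Inter>n. W n y)(x := \<Inter>n. G n)"
    by (rule INF_upd)
  ultimately have "(\<Inter>n. G n) \<subseteq> sat (Nu x \<phi>) (\<lambda>y. \<Inter>n. W n y)"
    by (auto intro!: gfp_upperbound)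
  moreover have "sat (Nu x \<phi>) (\<lambda>y. \<Inter>n. W n y) \<subseteq> G n" for n
    unfolding G_def by (rule sat_mono) auto
  ultimately show ?case unfolding G_def by blast
qed auto

lemma sat_Nu:
  fixes W :: "'v \<Rightarrow> ('c, 'l) tree set"
  assumes "only_bot_sums \<phi>"
  shows "sat (Nu x \<phi>) W = (\<Inter>n. ((\<lambda>Z. sat \<phi> (W(x := Z))) ^^ n) UNIV)"
proof -
  have "sat \<phi> (W(x := \<Inter>n. u n)) = (\<Inter>n. sat \<phi> (W(x := u n)))"
    if "antimono u" for u :: "nat \<Rightarrow> ('c, 'l) tree set"
  proof -
    have "antimono (\<lambda>n. W(x := u n))" using that by (intro antimono_upd) (auto intro: antimonoI)
    moreover have "(\<lambda>y. \<Inter>n. (W(x := u n)) y) = W(x := \<Inter>n. u n)"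
      using INF_upd[of "\<lambda>n. W" x u] by simp
    ultimately show ?thesis using sat_INT[OF assms, of "\<lambda>n. W(x := u n)"] by simp
  qed
  then show ?thesis by (simp add: gfp_eq_INF_funpow[OF mono_sat_upd])
qed

section \<open>Step-wise semantics\<close>

text \<open>Brings the products into the shape \<open>prod_list (map f xs)\<close>, to which the
  lemmas on finite products apply.\<close>

lemma step_sem_Modal:
  "step_sem \<gamma> (Modal l \<phi>s) V c =
    the (psum (\<lambda>cs. \<gamma> c (l, cs) * prod_list (map (\<lambda>(\<phi>, d). step_sem \<gamma> \<phi> V d) (zip \<phi>s cs)))
      {cs. \<gamma> c (l, cs) \<noteq> 0})"
  by (simp add: zip_map1 o_def case_prod_unfold)

lemma step_sem_Bot: "step_sem \<gamma> Bot V c = 0"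
  by (simp add: psum_list_def)

lemma step_sem_cong:
  "only_bot_sums \<phi> \<Longrightarrow> (\<And>x. x \<in> fv \<phi> \<Longrightarrow> V x = V' x) \<Longrightarrow> step_sem \<gamma> \<phi> V = step_sem \<gamma> \<phi> V'"
proof (induction \<phi> arbitrary: V V')
  case (Modal l \<phi>s)
  have "step_sem \<gamma> \<phi> V = step_sem \<gamma> \<phi> V'" if "\<phi> \<in> set \<phi>s" for \<phi>
    using Modal.prems that by (intro Modal.IH) (auto simp: list_all_iff)
  then have "map (\<lambda>(\<phi>, d). step_sem \<gamma> \<phi> V d) (zip \<phi>s cs) =
      map (\<lambda>(\<phi>, d). step_sem \<gamma> \<phi> V' d) (zip \<phi>s cs)" for cs
    by (auto dest: set_zip_leftD)
  then show ?case by (intro HOL.ext) (simp only: step_sem_Modal)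
next
  case (Mu x \<phi>)
  then have "step_sem \<gamma> \<phi> (V(x := p)) = step_sem \<gamma> \<phi> (V'(x := p))" for p by (intro Mu.IH) auto
  then show ?case by simp
next
  case (Nu x \<phi>)
  then have "step_sem \<gamma> \<phi> (V(x := p)) = step_sem \<gamma> \<phi> (V'(x := p))" for p by (intro Nu.IH) auto
  then show ?case by simp
qed auto

locale weighted_coalgebra =
  fixes ar :: "'l \<Rightarrow> nat" and \<gamma> :: "('c, 'l, 's::partial_comm_semiring) coalg"
  assumes coalgebra: "coalgebra ar \<gamma>"
begin

lemma finite_support: "finite {t. \<gamma> c t \<noteq> 0}"
  and psum_support: "psum (\<gamma> c) {t. \<gamma> c t \<noteq> 0} \<noteq> None"
  using coalgebra by (simp_all add: coalgebra_def TS_def)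

lemma length_successors: "\<gamma> c (l, cs) \<noteq> 0 \<Longrightarrow> length cs = ar l"
  using coalgebra by (force simp: coalgebra_def TS_def polyF_def)

lemma finite_successors: "finite {cs. \<gamma> c (l, cs) \<noteq> 0}"
  using finite_vimageI[OF finite_support[of c], of "Pair l"] by (simp add: vimage_def inj_on_def)

text \<open>\<open>Pair l\<close> embeds the successor lists for \<open>l\<close> into the support
  of \<open>\<gamma> c\<close>, so this is a subsum of the full sum.\<close>

lemma psum_successors_le:
  assumes "psum f {t. \<gamma> c t \<noteq> 0} = Some s"
  shows "\<exists>t\<le>s. psum (\<lambda>cs. f (l, cs)) {cs. \<gamma> c (l, cs) \<noteq> 0} = Some t"
proof -
  have "psum (\<lambda>cs. f (l, cs)) {cs. \<gamma> c (l, cs) \<noteq> 0} = psum f (Pair l ` {cs. \<gamma> c (l, cs) \<noteq> 0})"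
    by (rule psum_reindex[symmetric]) (simp_all add: finite_successors inj_on_def)
  then show ?thesis
    using psum_subset[OF finite_support _ assms, of "Pair l ` {cs. \<gamma> c (l, cs) \<noteq> 0}"] by auto
qed

lemma psum_successors: "psum (\<lambda>cs. \<gamma> c (l, cs)) {cs. \<gamma> c (l, cs) \<noteq> 0} \<noteq> None"
  using psum_support[of c] psum_successors_le[of "\<gamma> c"] by fastforce

lemma step_sem_strict:
  "x \<in> fv \<phi> \<Longrightarrow> V x = (\<lambda>c. 0) \<Longrightarrow> wf_form ar \<phi> \<Longrightarrow> only_bot_sums \<phi> \<Longrightarrow> step_sem \<gamma> \<phi> V = (\<lambda>c. 0)"
proof (induction \<phi> arbitrary: V)
  case (Modal l \<phi>s)
  then obtain \<phi> where \<phi>: "\<phi> \<in> set \<phi>s" "step_sem \<gamma> \<phi> V = (\<lambda>c. 0)" by (auto simp: list_all_iff)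
  \<comment> \<open>Lists in the support have length \<open>ar l\<close>, so \<open>zip\<close>
    drops no argument formula and every product contains the zero factor.\<close>
  have zero: "prod_list (map (\<lambda>(\<phi>, d). step_sem \<gamma> \<phi> V d) (zip \<phi>s cs)) = 0"
    if "\<gamma> c (l, cs) \<noteq> 0" for c cs
  proof -
    have "length cs = length \<phi>s" using length_successors[OF that] Modal.prems(3) by simp
    then obtain d where "(\<phi>, d) \<in> set (zip \<phi>s cs)"
      using \<phi>(1) by (metis in_set_impl_in_set_zip1)
    then show ?thesis by (rule prod_list_zero) (simp add: \<phi>(2))
  qed
  have "psum (\<lambda>cs. \<gamma> c (l, cs) * prod_list (map (\<lambda>(\<phi>, d). step_sem \<gamma> \<phi> V d) (zip \<phi>s cs)))
      {cs. \<gamma> c (l, cs) \<noteq> 0} = Some 0" for c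
  proof -
    have "psum (\<lambda>cs. \<gamma> c (l, cs) * prod_list (map (\<lambda>(\<phi>, d). step_sem \<gamma> \<phi> V d) (zip \<phi>s cs)))
      {cs. \<gamma> c (l, cs) \<noteq> 0} = psum (\<lambda>cs. 0) {cs. \<gamma> c (l, cs) \<noteq> 0}"
      by (rule psum_cong) (simp add: zero times_zero)
    then show ?thesis by (simp add: psum_zero finite_successors)
  qed
  then show ?case by (intro HOL.ext) (simp only: step_sem_Modal option.sel)
next
  case (Mu y \<phi>)
  then have "step_sem \<gamma> \<phi> (V(y := p)) = (\<lambda>c. 0)" for p by (intro Mu.IH) auto
  then show ?case by (simp add: lfp_const)
next
  case (Nu y \<phi>)
  then have "step_sem \<gamma> \<phi> (V(y := p)) = (\<lambda>c. 0)" for p by (intro Nu.IH) auto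
  then show ?case by (simp add: gfp_const)
qed auto

lemma step_sem_mono:
  "only_bot_sums \<phi> \<Longrightarrow> (\<And>x c. V x c \<le> V' x c) \<Longrightarrow> step_sem \<gamma> \<phi> V c \<le> step_sem \<gamma> \<phi> V' c"
proof (induction \<phi> arbitrary: V V' c)
  case (Modal l \<phi>s)
  have le: "step_sem \<gamma> \<phi> V d \<le> step_sem \<gamma> \<phi> V' d" if "\<phi> \<in> set \<phi>s" for \<phi> d
    using Modal.prems that by (intro Modal.IH) (auto simp: list_all_iff)
  show ?case
    unfolding step_sem_Modal
  proof (rule psum_weighted_mono[OF finite_successors psum_successors])
    fix cs
    show "prod_list (map (\<lambda>(\<phi>, d). step_sem \<gamma> \<phi> V d) (zip \<phi>s cs))
      \<le> prod_list (map (\<lambda>(\<phi>, d). step_sem \<gamma> \<phi> V' d) (zip \<phi>s cs))"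
      by (rule prod_list_mono) (auto dest: set_zip_leftD intro: le)
  qed
next
  case (Mu x \<phi>)
  then have "step_sem \<gamma> \<phi> (V(x := p)) \<le> step_sem \<gamma> \<phi> (V'(x := p))" for p
    by (intro le_funI Mu.IH) auto
  then have "step_sem \<gamma> (Mu x \<phi>) V \<le> step_sem \<gamma> (Mu x \<phi>) V'" by (auto intro!: lfp_mono)
  then show ?case by (rule le_funD)
next
  case (Nu x \<phi>)
  then have "step_sem \<gamma> \<phi> (V(x := p)) \<le> step_sem \<gamma> \<phi> (V'(x := p))" for p
    by (intro le_funI Nu.IH) auto
  then have "step_sem \<gamma> (Nu x \<phi>) V \<le> step_sem \<gamma> (Nu x \<phi>) V'" by (auto intro!: gfp_mono)
  then show ?case by (rule le_funD)
qed auto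

lemma mono_step_sem_upd: "only_bot_sums \<phi> \<Longrightarrow> mono (\<lambda>p. step_sem \<gamma> \<phi> (V(x := p)))"
  by (intro monoI le_funI step_sem_mono) (auto simp: le_fun_def)

text \<open>The counterpart of \<open>sat_Mu\<close>. In \<open>step_sem_INF\<close> it reduces the
  least fixpoint to a constant or to the induction hypothesis.\<close>

lemma step_sem_Mu:
  assumes "wf_form ar \<phi>" "only_bot_sums \<phi>"
  shows "step_sem \<gamma> (Mu x \<phi>) V = (if x \<in> fv \<phi> then (\<lambda>c. 0) else step_sem \<gamma> \<phi> V)"
proof (cases "x \<in> fv \<phi>")
  case True
  then have "step_sem \<gamma> \<phi> (V(x := \<lambda>c. 0)) = (\<lambda>c. 0)" using assms by (intro step_sem_strict) auto
  then have "step_sem \<gamma> (Mu x \<phi>) V \<le> (\<lambda>c. 0)" by (auto intro!: lfp_lowerbound)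
  then show ?thesis using True by (auto intro!: antisym le_funI)
next
  case False
  then have "step_sem \<gamma> \<phi> (V(x := p)) = step_sem \<gamma> \<phi> V" for p
    using assms by (intro step_sem_cong) auto
  then show ?thesis using False by (simp add: lfp_const)
qed

lemma step_sem_INF:
  fixes V :: "nat \<Rightarrow> 'v \<Rightarrow> 'c \<Rightarrow> 's"
  shows "wf_form ar \<phi> \<Longrightarrow> only_bot_sums \<phi> \<Longrightarrow> antimono V \<Longrightarrow>
    step_sem \<gamma> \<phi> (\<lambda>x. INF n. V n x) = (INF n. step_sem \<gamma> \<phi> (V n))"
proof (induction \<phi> arbitrary: V)
  case (Modal l \<phi>s)
  have IH: "step_sem \<gamma> \<phi> (\<lambda>x. INF n. V n x) d = (INF n. step_sem \<gamma> \<phi> (V n) d)"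
    if "\<phi> \<in> set \<phi>s" for \<phi> d
  proof -
    have "step_sem \<gamma> \<phi> (\<lambda>x. INF n. V n x) = (INF n. step_sem \<gamma> \<phi> (V n))"
      using Modal.prems that by (intro Modal.IH) (auto simp: list_all_iff)
    then show ?thesis by (simp only: INF_apply)
  qed
  have anti: "antimono (\<lambda>n. step_sem \<gamma> \<phi> (V n) d)" if "\<phi> \<in> set \<phi>s" for \<phi> d
  proof (intro antimonoI step_sem_mono)
    show "only_bot_sums \<phi>" using Modal.prems(2) that by (simp add: list_all_iff)
    show "V n x c \<le> V m x c" if "m \<le> n" for m n x c
      using antimonoD[OF Modal.prems(3) that] by (simp add: le_fun_def)
  qed
  show ?case
  proof
    fix c
    \<comment> \<open>The infimum passes first through the finite products, then through the
      coefficients and the sum.\<close>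
    define u where "u n cs = prod_list (map (\<lambda>(\<phi>, d). step_sem \<gamma> \<phi> (V n) d) (zip \<phi>s cs))" for n cs
    have "prod_list (map (\<lambda>(\<phi>, d). step_sem \<gamma> \<phi> (\<lambda>x. INF n. V n x) d) (zip \<phi>s cs)) = (INF n. u n cs)"
      for cs
    proof -
      have "map (\<lambda>(\<phi>, d). step_sem \<gamma> \<phi> (\<lambda>x. INF n. V n x) d) (zip \<phi>s cs) =
          map (\<lambda>t. INF n. (\<lambda>(\<phi>, d). step_sem \<gamma> \<phi> (V n) d) t) (zip \<phi>s cs)"
        by (auto dest: set_zip_leftD simp: IH)
      also have "prod_list \<dots> = (INF n. u n cs)"
        unfolding u_def by (rule prod_list_INF) (auto dest: set_zip_leftD intro: anti)
      finally show ?thesis .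
    qed
    moreover have "antimono (\<lambda>n. u n cs)" for cs
      unfolding u_def
      by (intro antimonoI prod_list_mono) (auto dest!: set_zip_leftD intro: antimonoD[OF anti])
    ultimately show "step_sem \<gamma> (Modal l \<phi>s) (\<lambda>x. INF n. V n x) c =
        (INF n. step_sem \<gamma> (Modal l \<phi>s) (V n)) c"
      unfolding INF_apply step_sem_Modal
      by (simp only: psum_weighted_INF[OF finite_successors psum_successors] u_def)
  qed
next
  case (WSum ws)
  then show ?case by simp
next
  case (Mu x \<phi>)
  then show ?case by (simp add: step_sem_Mu del: step_sem.simps)
next
  case (Nu x \<phi>)
  then have bot_sums: "only_bot_sums \<phi>" by simp
  \<comment> \<open>As in \<open>sat_INT\<close>, the infimum of the stagewise greatest fixpoints is
    a fixpoint for the limit valuation.\<close>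
  define G where "G n = step_sem \<gamma> (Nu x \<phi>) (V n)" for n
  have G: "step_sem \<gamma> \<phi> ((V n)(x := G n)) = G n" for n
    using gfp_unfold[OF mono_step_sem_upd[OF bot_sums], of "V n" x] by (simp add: G_def)
  have anti_V: "V n y c \<le> V m y c" if "m \<le> n" for m n y c
    using antimonoD[OF Nu.prems(3) that] by (auto simp: le_fun_def)
  have "antimono G"
    unfolding G_def using Nu.prems(2) by (intro antimonoI le_funI step_sem_mono anti_V)
  then have "antimono (\<lambda>n. (V n)(x := G n))"
    by (rule antimono_upd[OF Nu.prems(3)])
  then have "step_sem \<gamma> \<phi> (\<lambda>y. INF n. ((V n)(x := G n)) y) = (INF n. G n)"
    using Nu.IH[of "\<lambda>n. (V n)(x := G n)"] Nu.prems(1,2)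
    by (simp only: G wf_form.simps only_bot_sums.simps)
  then have "(INF n. G n) \<le> step_sem \<gamma> (Nu x \<phi>) (\<lambda>y. INF n. V n y)"
    unfolding INF_upd by (auto intro!: gfp_upperbound)
  moreover have "step_sem \<gamma> (Nu x \<phi>) (\<lambda>y. INF n. V n y) \<le> G n" for n
    unfolding G_def using Nu.prems(2)
    by (intro le_funI step_sem_mono) (auto simp: image_image intro: INF_lower)
  ultimately show ?case unfolding G_def by (intro antisym INF_greatest)
qed auto

section \<open>The extent as an infimum of approximations, and bounds by it\<close>

definition extent_step :: "('c \<Rightarrow> 's) \<Rightarrow> 'c \<Rightarrow> 's" where
  "extent_step p c = the (psum (\<lambda>t. \<gamma> c t * prod_list (map p (snd t))) {t. \<gamma> c t \<noteq> 0})"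

lemma ext_eq_gfp: "ext \<gamma> = gfp extent_step"
  by (simp add: ext_def extent_step_def[abs_def] case_prod_unfold)

lemma mono_extent_step: "mono extent_step"
  unfolding extent_step_def
  by (intro monoI le_funI psum_weighted_mono[OF finite_support psum_support] prod_list_mono)
    (auto simp: le_fun_def)

lemma extent_step_INF:
  assumes "antimono (u :: nat \<Rightarrow> 'c \<Rightarrow> 's)"
  shows "extent_step (INF n. u n) = (INF n. extent_step (u n))"
proof
  fix c
  have anti: "antimono (\<lambda>n. u n d)" for d
    using antimonoD[OF assms] by (intro antimonoI) (simp add: le_fun_def)
  have prod: "prod_list (map (INF n. u n) cs) = (INF n. prod_list (map (u n) cs))" for cs
    using prod_list_INF[of cs u] anti by (simp add: INF_apply[abs_def])
  have "antimono (\<lambda>n. prod_list (map (u n) cs))" for cs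
    by (intro antimonoI prod_list_mono) (rule antimonoD[OF anti])
  then show "extent_step (INF n. u n) c = (INF n. extent_step (u n)) c"
    unfolding INF_apply extent_step_def prod
    by (intro psum_weighted_INF[OF finite_support psum_support])
qed

text \<open>Stage 0 bounds every predicate, so stagewise bounds have a trivial base case.\<close>

definition extent_iterate :: "nat \<Rightarrow> 'c \<Rightarrow> 's" where
  "extent_iterate n = (extent_step ^^ n) top"

lemma le_extent_iterate_0 [simp]: "p \<le> extent_iterate 0"
  and extent_iterate_Suc [simp]: "extent_iterate (Suc n) = extent_step (extent_iterate n)"
  unfolding extent_iterate_def by simp_all

lemma ext_eq_INF: "ext \<gamma> = (INF n. extent_iterate n)"
  unfolding ext_eq_gfp extent_iterate_def
  by (rule gfp_eq_INF_funpow[OF mono_extent_step]) (simp_all add: extent_step_INF)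

text \<open>Two estimates combine: each factor is bounded by \<open>q\<close>, and the sum over the
  successors for the single symbol \<open>l\<close> is part of the sum over the whole
  support.\<close>

lemma step_sem_Modal_le:
  assumes "length \<phi>s = ar l" "\<And>\<phi> d. \<phi> \<in> set \<phi>s \<Longrightarrow> step_sem \<gamma> \<phi> V d \<le> q d"
  shows "step_sem \<gamma> (Modal l \<phi>s) V c \<le> extent_step q c"
proof -
  define f where "f t = \<gamma> c t * prod_list (map q (snd t))" for t
  have prod_le: "prod_list (map (\<lambda>(\<phi>, d). step_sem \<gamma> \<phi> V d) (zip \<phi>s cs)) \<le> prod_list (map q cs)"
    if "\<gamma> c (l, cs) \<noteq> 0" for cs
  proof -
    have "prod_list (map (\<lambda>(\<phi>, d). step_sem \<gamma> \<phi> V d) (zip \<phi>s cs)) \<le>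
        prod_list (map (\<lambda>(\<phi>, d). q d) (zip \<phi>s cs))"
      by (rule prod_list_mono) (auto dest: set_zip_leftD intro: assms(2))
    moreover have "map (\<lambda>(\<phi>, d). q d) (zip \<phi>s cs) = map q cs"
      using length_successors[OF that] assms(1)
      by (intro nth_equalityI) simp_all
    ultimately show ?thesis by simp
  qed
  have "step_sem \<gamma> (Modal l \<phi>s) V c \<le> the (psum (\<lambda>cs. f (l, cs)) {cs. \<gamma> c (l, cs) \<noteq> 0})"
    unfolding step_sem_Modal f_def snd_conv
    by (rule psum_weighted_mono[OF finite_successors psum_successors]) (simp add: prod_le)
  also have "\<dots> \<le> extent_step q c"
    using psum_successors_le[of f c "extent_step q c" l]
      psum_weighted_defined[OF finite_support psum_support]
    by (auto simp: f_def[abs_def] extent_step_def)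
  finally show ?thesis .
qed

lemma antimono_extent_iterates: "antimono extent_iterate"
  unfolding extent_iterate_def by (rule antimono_funpow[OF mono_extent_step]) simp

text \<open>
  The two bounds record that a modality gains one iteration of the extent operator, so that a
  guarded variable need only satisfy the bound of the previous stage.
\<close>

lemma step_sem_le_extent_iterate:
  "wf_form ar \<phi> \<Longrightarrow> only_bot_sums \<phi> \<Longrightarrow> nu_guarded \<phi> \<Longrightarrow>
    (\<And>x. x \<in> unguarded_vars \<phi> \<Longrightarrow> V x \<le> extent_iterate k) \<Longrightarrow>
    (\<And>x. x \<in> fv \<phi> \<Longrightarrow> V x \<le> extent_iterate (k - 1)) \<Longrightarrow>
    step_sem \<gamma> \<phi> V \<le> extent_iterate k"
proof (induction \<phi> arbitrary: V k)
  case Top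
  show ?case unfolding step_sem.simps ext_eq_INF by (rule INF_lower) simp
next
  case (Modal l \<phi>s)
  show ?case
  proof (cases k)
    \<comment> \<open>Only a positive stage needs work. There \<open>k - 1\<close> is
      \<open>n\<close>, so the bound on all free variables is the one required of the arguments at
      stage \<open>n\<close>, and the modality restores the lost stage.\<close>
    case (Suc n)
    have "step_sem \<gamma> \<phi> V \<le> extent_iterate n" if \<phi>: "\<phi> \<in> set \<phi>s" for \<phi>
    proof (rule Modal.IH[OF \<phi>])
      have le: "V x \<le> extent_iterate n" if "x \<in> fv \<phi>" for x
        using Modal.prems(5)[of x] that \<phi> Suc by auto
      then show "V x \<le> extent_iterate n" if "x \<in> unguarded_vars \<phi>" for x
        using that unguarded_vars_subset_fv[of \<phi>] by auto
      show "V x \<le> extent_iterate (n - 1)" if "x \<in> fv \<phi>" for x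
        using le[OF that] antimonoD[OF antimono_extent_iterates, of "n - 1" n] by simp
    qed (use Modal.prems(1-3) \<phi> in \<open>auto simp: list_all_iff\<close>)
    then show ?thesis
      using Modal.prems(1) Suc by (auto intro!: le_funI step_sem_Modal_le dest: le_funD
        simp del: step_sem.simps)
  qed (simp del: step_sem.simps)
next
  case (WSum ws)
  then show ?case by (auto simp: psum_list_def le_fun_def)
next
  case (Mu x \<phi>)
  \<comment> \<open>The approximation is a prefixed point of the body, so it bounds the least
    fixpoint even if \<open>x\<close> is unguarded.\<close>
  have "step_sem \<gamma> \<phi> (V(x := extent_iterate k)) \<le> extent_iterate k"
    using Mu.prems antimonoD[OF antimono_extent_iterates, of "k - 1" k] by (intro Mu.IH) auto
  then show ?case by (auto intro: lfp_lowerbound)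
next
  case (Nu x \<phi>)
  define p where "p = step_sem \<gamma> (Nu x \<phi>) V"
  have p: "step_sem \<gamma> \<phi> (V(x := p)) = p"
    using gfp_unfold[OF mono_step_sem_upd, of \<phi> V x] Nu.prems(2) by (simp add: p_def)
  \<comment> \<open>A greatest fixpoint has to climb through the stages: since \<open>x\<close> is
    guarded, \<open>p\<close> below stage \<open>j\<close> suffices for the body, which equals
    \<open>p\<close>, to lie below stage \<open>Suc j\<close>.\<close>
  have "p \<le> extent_iterate j" if "j \<le> k" for j
    using that
  proof (induction j)
    case (Suc j)
    have "step_sem \<gamma> \<phi> (V(x := p)) \<le> extent_iterate (Suc j)"
    proof (rule Nu.IH)
      show "(V(x := p)) y \<le> extent_iterate (Suc j)" if "y \<in> unguarded_vars \<phi>" for y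
      proof -
        have "V y \<le> extent_iterate k" "y \<noteq> x" using that Nu.prems(3) Nu.prems(4)[of y] by auto
        then show ?thesis
          using antimonoD[OF antimono_extent_iterates Suc.prems] by (auto intro: order_trans)
      qed
      show "(V(x := p)) y \<le> extent_iterate (Suc j - 1)" if "y \<in> fv \<phi>" for y
      proof (cases "y = x")
        case False
        then have "V y \<le> extent_iterate (k - 1)" using that Nu.prems(5)[of y] by auto
        moreover have "j \<le> k - 1" using Suc.prems by simp
        then have "extent_iterate (k - 1) \<le> extent_iterate j"
          by (rule antimonoD[OF antimono_extent_iterates])
        ultimately show ?thesis using False by simp
      qed (use Suc in simp)
    qed (use Nu.prems in auto)
    then show ?case by (simp add: p)
  qed simp
  then show ?case unfolding p_def by blast
qed auto

text \<open>Variables below the extent meet both bounds of \<open>step_sem_le_extent_iterate\<close>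
  at every stage, and the extent is the infimum of the stages.\<close>

lemma step_sem_le_ext:
  assumes "wf_form ar \<phi>" "only_bot_sums \<phi>" "nu_guarded \<phi>" "\<And>x. x \<in> fv \<phi> \<Longrightarrow> V x \<le> ext \<gamma>"
  shows "step_sem \<gamma> \<phi> V \<le> ext \<gamma>"
proof -
  have le: "V x \<le> extent_iterate n" if "x \<in> fv \<phi>" for x n
    using assms(4)[OF that] unfolding ext_eq_INF by (meson INF_lower UNIV_I order_trans)
  have "step_sem \<gamma> \<phi> V \<le> extent_iterate n" for n
    using assms(1-3) unguarded_vars_subset_fv[of \<phi>]
    by (intro step_sem_le_extent_iterate) (auto intro: le)
  then show ?thesis unfolding ext_eq_INF by (rule INF_greatest)
qed

text \<open>Guardedness, through \<open>step_sem_le_ext\<close>, yields both conditions on the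
  start: the body maps the extent below itself, and the greatest fixpoint lies below it. This start
  is the measure of the set of all paths.\<close>

lemma step_sem_Nu:
  assumes "wf_form ar \<phi>" "only_bot_sums \<phi>" "nu_guarded (Nu x \<phi>)"
    and V: "\<And>y. y \<in> fv (Nu x \<phi>) \<Longrightarrow> V y \<le> ext \<gamma>"
  shows "step_sem \<gamma> (Nu x \<phi>) V = (INF n. ((\<lambda>p. step_sem \<gamma> \<phi> (V(x := p))) ^^ n) (ext \<gamma>))"
  unfolding step_sem.simps
proof (rule gfp_eq_INF_funpow)
  show "mono (\<lambda>p. step_sem \<gamma> \<phi> (V(x := p)))" by (rule mono_step_sem_upd[OF assms(2)])
  show "step_sem \<gamma> \<phi> (V(x := ext \<gamma>)) \<le> ext \<gamma>"
    using assms by (intro step_sem_le_ext) auto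
  have "step_sem \<gamma> (Nu x \<phi>) V \<le> ext \<gamma>"
    using assms(1-3) V by (intro step_sem_le_ext) auto
  then show "gfp (\<lambda>p. step_sem \<gamma> \<phi> (V(x := p))) \<le> ext \<gamma>" by simp
  show "step_sem \<gamma> \<phi> (V(x := INF n. u n)) = (INF n. step_sem \<gamma> \<phi> (V(x := u n)))"
    if "antimono u" for u :: "nat \<Rightarrow> 'c \<Rightarrow> 's"
  proof -
    have "antimono (\<lambda>n. V(x := u n))" using that by (intro antimono_upd) (auto intro: antimonoI)
    moreover have "(\<lambda>y. INF n. (V(x := u n)) y) = V(x := INF n. u n)"
      using INF_upd[of "\<lambda>n. V" x u] by simp
    ultimately show ?thesis using step_sem_INF[OF assms(1,2), of "\<lambda>n. V(x := u n)"] by simp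
  qed
qed

section \<open>Measures of sets of paths\<close>

lemma measure_value_empty: "measure_value ar \<gamma> c {} 0"
  using measure_value.intros(3)[of 0 ar \<gamma> c "\<lambda>_. {}" "\<lambda>_. 0" 0]
  by (simp add: disjoint_family_on_def)

lemma measure_value_finite_UN:
  assumes "finite I" "\<And>i. i \<in> I \<Longrightarrow> measure_value ar \<gamma> c (P i) (w i)"
    "disjoint_family_on P I" "psum w I = Some v"
  shows "measure_value ar \<gamma> c (\<Union>i\<in>I. P i) v"
proof -
  \<comment> \<open>The clause for disjoint unions is indexed by an initial segment of the naturals,
    so \<open>I\<close> is enumerated.\<close>
  obtain h where h: "bij_betw h {..<card I} I"
    using ex_bij_betw_nat_finite[OF assms(1)] atLeast0LessThan by metis
  then have inj: "inj_on h {..<card I}" and img: "h ` {..<card I} = I"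
    by (auto simp: bij_betw_def)
  have "measure_value ar \<gamma> c (\<Union>i<card I. P (h i)) v"
  proof (rule measure_value.intros(3))
    show "\<forall>i<card I. measure_value ar \<gamma> c (P (h i)) (w (h i))" using assms(2) img by auto
    show "disjoint_family_on (\<lambda>i. P (h i)) {..<card I}"
      unfolding disjoint_family_on_def
    proof (intro ballI impI)
      fix i j assume ij: "i \<in> {..<card I}" "j \<in> {..<card I}" "i \<noteq> j"
      then have "h i \<noteq> h j" "h i \<in> I" "h j \<in> I" using inj img by (auto dest: inj_onD)
      then show "P (h i) \<inter> P (h j) = {}" using assms(3) by (auto simp: disjoint_family_on_def)
    qed
    show "psum (\<lambda>i. w (h i)) {..<card I} = Some v"
      using psum_reindex[OF finite_lessThan inj, of w] assms(4) img by simp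
  qed
  moreover have "(\<Union>i<card I. P (h i)) = (\<Union>i\<in>I. P i)"
    using arg_cong[OF img, of "\<lambda>J. \<Union> (P ` J)"] by (simp add: image_image)
  ultimately show ?thesis by simp
qed

lemma Paths_iff:
  "Node c l zs \<in> Paths ar \<gamma> d \<longleftrightarrow>
    c = d \<and> \<gamma> c (l, map state zs) \<noteq> 0 \<and> (\<forall>z\<in>set zs. z \<in> Paths ar \<gamma> (state z))"
proof -
  have "wf_tree ar (Node c l zs) \<longleftrightarrow> length zs = ar l \<and> (\<forall>z\<in>set zs. wf_tree ar z)"
    by (subst wf_tree.simps) simp
  moreover have "follows \<gamma> (Node c l zs) \<longleftrightarrow>
      \<gamma> c (l, map state zs) \<noteq> 0 \<and> (\<forall>z\<in>set zs. follows \<gamma> z)"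
    by (subst follows.simps) simp
  \<comment> \<open>The arity condition at the root follows from the nonzero weight, as only lists
    of the right length lie in the support.\<close>
  ultimately show ?thesis
    using length_successors[of c l "map state zs"] by (auto simp: Paths_def)
qed

text \<open>The paths are sorted by the list of root states of the children, which gives finitely
  many cylinders because the support is finite.\<close>

lemma Paths_sat_Modal:
  assumes "length \<phi>s = ar l"
  shows "Paths ar \<gamma> c \<inter> sat (Modal l \<phi>s) W =
    (\<Union>cs\<in>{cs. \<gamma> c (l, cs) \<noteq> 0}.
      cylinder c l (map (\<lambda>(\<phi>, d). Paths ar \<gamma> d \<inter> sat \<phi> W) (zip \<phi>s cs)))"
    (is "?L = ?R")
proof (intro set_eqI iffI)
  fix z assume z: "z \<in> ?L"
  obtain c' l' zs where [simp]: "z = Node c' l' zs" by (cases z)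
  have "c' = c" "l' = l" "\<gamma> c (l, map state zs) \<noteq> 0" "\<forall>z\<in>set zs. z \<in> Paths ar \<gamma> (state z)"
    "length zs = length \<phi>s" "\<forall>i<length zs. zs ! i \<in> sat (\<phi>s ! i) W"
    using z by (auto simp: Paths_iff list_all2_conv_all_nth)
  then show "z \<in> ?R"
    by (auto simp: cylinder_def list_all2_conv_all_nth intro!: exI[of _ "map state zs"])
next
  fix z assume "z \<in> ?R"
  then obtain cs zs where cs: "\<gamma> c (l, cs) \<noteq> 0" and [simp]: "z = Node c l zs"
    and zs: "list_all2 (\<in>) zs (map (\<lambda>(\<phi>, d). Paths ar \<gamma> d \<inter> sat \<phi> W) (zip \<phi>s cs))"
    by (auto simp: cylinder_def)
  have len: "length zs = length cs" "length \<phi>s = length cs"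
    using zs assms length_successors[OF cs] by (auto dest: list_all2_lengthD)
  have nth: "zs ! i \<in> Paths ar \<gamma> (cs ! i)" "zs ! i \<in> sat (\<phi>s ! i) W" if "i < length cs" for i
    using list_all2_nthD[OF zs, of i] that len by auto
  \<comment> \<open>A path from \<open>cs ! i\<close> has root state \<open>cs ! i\<close>, so the
    cylinder determines the successor list.\<close>
  have "map state zs = cs"
    using nth(1) len(1) by (intro nth_equalityI) (auto simp: Paths_def)
  moreover have "z \<in> Paths ar \<gamma> (state z)" if "z \<in> set zs" for z
    using that nth(1) len(1) by (auto simp: in_set_conv_nth Paths_def)
  moreover have "list_all2 (\<lambda>z s. z \<in> s W) zs (map sat \<phi>s)"
    using nth(2) len by (simp add: list_all2_conv_all_nth)
  ultimately show "z \<in> ?L"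
    using cs by (simp add: Paths_iff)
qed

text \<open>The generalisation to open formulas needed for induction: the two valuations must
  correspond on the free variables, and the bound by the extent is carried along so that
  \<open>step_sem_Nu\<close> applies.\<close>

lemma measure_value_step_sem:
  "wf_form ar \<phi> \<Longrightarrow> only_bot_sums \<phi> \<Longrightarrow> nu_guarded \<phi> \<Longrightarrow>
    (\<And>x. x \<in> fv \<phi> \<Longrightarrow> V x \<le> ext \<gamma>) \<Longrightarrow>
    (\<And>x c. x \<in> fv \<phi> \<Longrightarrow> measure_value ar \<gamma> c (Paths ar \<gamma> c \<inter> W x) (V x c)) \<Longrightarrow>
    measure_value ar \<gamma> c (Paths ar \<gamma> c \<inter> sat \<phi> W) (step_sem \<gamma> \<phi> V c)"
proof (induction \<phi> arbitrary: V W c)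
  case Top
  show ?case by (simp add: measure_value.intros(1))
next
  case (Modal l \<phi>s)
  have len: "length \<phi>s = ar l" using Modal.prems(1) by simp
  have IH: "measure_value ar \<gamma> d (Paths ar \<gamma> d \<inter> sat \<phi> W) (step_sem \<gamma> \<phi> V d)"
    if "\<phi> \<in> set \<phi>s" for \<phi> d
  proof (rule Modal.IH[OF that])
    show "measure_value ar \<gamma> c (Paths ar \<gamma> c \<inter> W x) (V x c)" if "x \<in> fv \<phi>" for x c
      using that \<open>\<phi> \<in> set \<phi>s\<close> by (intro Modal.prems(5)) auto
  qed (use Modal.prems(1-4) that in \<open>auto simp: list_all_iff\<close>)
  show ?case
    unfolding Paths_sat_Modal[of \<phi>s l, OF len] step_sem_Modal
  proof (rule measure_value_finite_UN[OF finite_successors])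
    fix cs assume "cs \<in> {cs. \<gamma> c (l, cs) \<noteq> 0}"
    then show "measure_value ar \<gamma> c
        (cylinder c l (map (\<lambda>(\<phi>, d). Paths ar \<gamma> d \<inter> sat \<phi> W) (zip \<phi>s cs)))
        (\<gamma> c (l, cs) * prod_list (map (\<lambda>(\<phi>, d). step_sem \<gamma> \<phi> V d) (zip \<phi>s cs)))"
      using len length_successors[of c l cs]
      by (intro measure_value.intros(2)) (auto intro!: IH)
  next
    show "disjoint_family_on
        (\<lambda>cs. cylinder c l (map (\<lambda>(\<phi>, d). Paths ar \<gamma> d \<inter> sat \<phi> W) (zip \<phi>s cs)))
        {cs. \<gamma> c (l, cs) \<noteq> 0}"
      unfolding disjoint_family_on_def
    proof (intro ballI impI equals0I)
      fix cs cs' z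
      assume cs: "cs \<in> {cs. \<gamma> c (l, cs) \<noteq> 0}" "cs' \<in> {cs. \<gamma> c (l, cs) \<noteq> 0}" "cs \<noteq> cs'"
        and z: "z \<in> cylinder c l (map (\<lambda>(\<phi>, d). Paths ar \<gamma> d \<inter> sat \<phi> W) (zip \<phi>s cs)) \<inter>
          cylinder c l (map (\<lambda>(\<phi>, d). Paths ar \<gamma> d \<inter> sat \<phi> W) (zip \<phi>s cs'))"
      \<comment> \<open>A tree in a cylinder reveals the successor list through the states of its
        children, so distinct lists give disjoint cylinders.\<close>
      have states: "map state (children z) = ds"
        if "z \<in> cylinder c l (map (\<lambda>(\<phi>, d). Paths ar \<gamma> d \<inter> sat \<phi> W) (zip \<phi>s ds))"
          "\<gamma> c (l, ds) \<noteq> 0" for ds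
        using that(1) length_successors[OF that(2)] len
        by (intro nth_equalityI) (auto simp: cylinder_def list_all2_conv_all_nth Paths_def)
      show False using states[of cs] states[of cs'] cs z by auto
    qed
  qed (rule psum_weighted_defined[OF finite_successors psum_successors])
next
  case (WSum ws)
  then show ?case using measure_value_empty by (simp add: step_sem_Bot del: step_sem.simps)
next
  case (Mu x \<phi>)
  show ?case
  proof (cases "x \<in> fv \<phi>")
    case True
    then show ?thesis
      using Mu.prems by (simp add: sat_Mu step_sem_Mu measure_value_empty del: sat.simps step_sem.simps)
  next
    case False
    then have "measure_value ar \<gamma> c (Paths ar \<gamma> c \<inter> sat \<phi> W) (step_sem \<gamma> \<phi> V c)"
      using Mu.prems by (intro Mu.IH) auto
    then show ?thesis
      using False Mu.prems by (simp add: sat_Mu step_sem_Mu del: sat.simps step_sem.simps)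
  qed
next
  case (Nu x \<phi>)
  define f where "f p = step_sem \<gamma> \<phi> (V(x := p))" for p
  define g where "g Z = sat \<phi> (W(x := Z))" for Z
  have bot_sums: "only_bot_sums \<phi>" and wf: "wf_form ar \<phi>" using Nu.prems by auto
  have step: "step_sem \<gamma> (Nu x \<phi>) V c = (INF n. (f ^^ n) (ext \<gamma>) c)"
    using step_sem_Nu[OF wf bot_sums Nu.prems(3,4)] by (simp add: f_def[abs_def] image_image)
  have sat: "Paths ar \<gamma> c \<inter> sat (Nu x \<phi>) W = (\<Inter>n. Paths ar \<gamma> c \<inter> (g ^^ n) UNIV)"
    unfolding sat_Nu[OF bot_sums] g_def[abs_def] by blast
  \<comment> \<open>Stage 0 pairs all paths with the extent. The bound belongs to the invariant
    because the induction hypothesis for the body asks for it at the updated variable.\<close>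
  have iter: "(f ^^ n) (ext \<gamma>) \<le> ext \<gamma> \<and>
    (\<forall>c. measure_value ar \<gamma> c (Paths ar \<gamma> c \<inter> (g ^^ n) UNIV) ((f ^^ n) (ext \<gamma>) c))" for n
  proof (induction n)
    case 0
    show ?case by (simp add: measure_value.intros(1))
  next
    case (Suc n)
    have "step_sem \<gamma> \<phi> (V(x := (f ^^ n) (ext \<gamma>))) \<le> ext \<gamma>"
      using Nu.prems Suc by (intro step_sem_le_ext) auto
    moreover have "measure_value ar \<gamma> c (Paths ar \<gamma> c \<inter> sat \<phi> (W(x := (g ^^ n) UNIV)))
      (step_sem \<gamma> \<phi> (V(x := (f ^^ n) (ext \<gamma>))) c)" for c
      using Nu.prems Suc by (intro Nu.IH) auto
    moreover have "(f ^^ Suc n) (ext \<gamma>) = step_sem \<gamma> \<phi> (V(x := (f ^^ n) (ext \<gamma>)))"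
      "(g ^^ Suc n) UNIV = sat \<phi> (W(x := (g ^^ n) UNIV))"
      by (simp_all add: f_def g_def)
    ultimately show ?case by (simp only: simp_thms)
  qed
  have "antimono (\<lambda>n. (g ^^ n) UNIV)"
    unfolding g_def by (rule antimono_funpow[OF mono_sat_upd]) simp
  then have "\<forall>n. Paths ar \<gamma> c \<inter> (g ^^ Suc n) UNIV \<subseteq> Paths ar \<gamma> c \<inter> (g ^^ n) UNIV"
    unfolding antimono_iff_le_Suc by blast
  then show ?case unfolding step sat using iter by (intro measure_value.intros(5)) auto
qed auto

end

text \<open>By rule induction, each clause forces the value of any function that obeys all clauses.
  Measurability is proved simultaneously because \<open>induced_measure\<close> constrains
  measurable sets only.\<close>

lemma measure_value_imp_induced_measure:
  assumes "measure_value ar \<gamma> c P v" "induced_measure ar \<gamma> m"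
  shows "measurable ar \<gamma> c P \<and> m c P = v"
proof -
  have m_Paths: "m c (Paths ar \<gamma> c) = ext \<gamma> c" for c
    using assms(2) by (simp add: induced_measure_def)
  have m_cylinder: "m c (cylinder c l Ps) = \<gamma> c (l, cs) * prod_list (map2 m cs Ps)"
    if "\<gamma> c (l, cs) \<noteq> 0" "list_all2 (measurable ar \<gamma>) cs Ps" for c l cs Ps
    using assms(2) that by (simp add: induced_measure_def)
  have m_union: "psum (\<lambda>i. m c (P i)) {..<k} = Some (m c (\<Union>i<k. P i))"
    if "\<forall>i<k. measurable ar \<gamma> c (P i)" "disjoint_family_on P {..<k}" for c P and k :: nat
    using assms(2) that by (simp add: induced_measure_def)
  have m_SUP: "m c (\<Union>n. P n) = (SUP n. m c (P n))"
    if "\<forall>n. measurable ar \<gamma> c (P n)" "\<forall>n. P n \<subseteq> P (Suc n)" for c and P :: "nat \<Rightarrow> _"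
    using assms(2) that by (simp add: induced_measure_def)
  have m_INF: "m c (\<Inter>n. P n) = (INF n. m c (P n))"
    if "\<forall>n. measurable ar \<gamma> c (P n)" "\<forall>n. P (Suc n) \<subseteq> P n" for c and P :: "nat \<Rightarrow> _"
    using assms(2) that by (simp add: induced_measure_def)
  show ?thesis
    using assms(1)
  proof induction
    case (1 c)
    show ?case by (simp add: m_Paths measurable.intros(1))
  next
    case (2 c l cs Ps vs)
    then have meas: "list_all2 (measurable ar \<gamma>) cs Ps" and vs: "map2 m cs Ps = vs"
      by (auto simp: list_all2_conv_all_nth intro!: nth_equalityI)
    show ?case using m_cylinder[OF 2(1) meas] measurable.intros(2)[OF 2(1) meas] vs by simp
  next
    case (3 k c P w v)
    then have meas: "\<forall>i<k. measurable ar \<gamma> c (P i)" by blast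
    have "psum (\<lambda>i. m c (P i)) {..<k} = psum w {..<k}"
      using 3 by (intro psum_cong) auto
    then show ?case
      using m_union[OF meas 3(2)] measurable.intros(3)[OF meas 3(2)] 3(3) by simp
  next
    case (4 c P w)
    then have meas: "\<forall>n. measurable ar \<gamma> c (P n)" by blast
    show ?case
      using m_SUP[OF meas 4(2)] measurable.intros(4)[OF meas 4(2)] 4(1) by simp
  next
    case (5 c P w)
    then have meas: "\<forall>n. measurable ar \<gamma> c (P n)" by blast
    show ?case
      using m_INF[OF meas 5(2)] measurable.intros(5)[OF meas 5(2)] 5(1) by simp
  qed
qed

text \<open>The clauses may assign several values to one set, so derivability of the value comes
  first; equality then follows for each function that obeys the clauses.\<close>

theorem theorem5p1:
  fixes ar :: "'l \<Rightarrow> nat"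
    and \<gamma> :: "('c, 'l, 's::partial_comm_semiring) coalg"
    and \<phi> :: "('l, 'v, 's) form"
    and c :: 'c
    and V :: "'v \<Rightarrow> 'c \<Rightarrow> 's"
    and W :: "'v \<Rightarrow> ('c, 'l) tree set"
  assumes "coalgebra ar \<gamma>"
    and "\<phi> \<in> muL0 ar"
    and "nu_guarded \<phi>"
  shows "measure_value ar \<gamma> c (Paths_sat ar \<gamma> c \<phi> W) (step_sem \<gamma> \<phi> V c) \<and>
    (\<forall>m. induced_measure ar \<gamma> m \<longrightarrow> step_sem \<gamma> \<phi> V c = m c (Paths_sat ar \<gamma> c \<phi> W))"
proof -
  interpret weighted_coalgebra ar \<gamma> by unfold_locales (rule assms(1))
  have "Paths_sat ar \<gamma> c \<phi> W = Paths ar \<gamma> c \<inter> sat \<phi> W" by (auto simp: Paths_sat_def)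
  \<comment> \<open>Closedness makes the conditions on \<open>V\<close> and \<open>W\<close>
    vacuous.\<close>
  then have "measure_value ar \<gamma> c (Paths_sat ar \<gamma> c \<phi> W) (step_sem \<gamma> \<phi> V c)"
    using assms(2,3) measure_value_step_sem[of \<phi> V W c] by (simp add: muL0_def)
  then show ?thesis using measure_value_imp_induced_measure by metis
qed

end
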